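(* Let $\Omega$ be a countably infinite set and $\rho,\rho'$ preorders on $\Omega$. Then $E(\rho)\approx E(\rho')$ if and only if $\rho$ and $\rho'$ are of the same type, where the types are 1, 2, 3a, 3b, 4 as defined below.
   Context: $E=\mathrm{Self}(\Omega)$ is the monoid of maps $\Omega\to\Omega$, written on the right. For a preorder $\rho$ on $\Omega$, $E(\rho)=\{f\in E:(\alpha,(\alpha)f)\in\rho\ \forall\alpha\in\Omega\}$, and $\Delta_\rho(\alpha)=\{\beta:(\alpha,\beta)\in\rho\}$. Type 1: there is an infinite $\Gamma\subseteq\Omega$ with $\Delta_\rho(\alpha)$ infinite for all $\alpha\in\Gamma$. Type 2: the cardinalities $|\Delta_\rho(\alpha)|$ have no common finite upper bound, but $\Delta_\rho(\alpha)$ is infinite for only finitely many $\alpha$. Type 3: there is $n\in\omega$ with $|\Delta_\rho(\alpha)|\le n$ for all but finitely many $\alpha$, and $|\Delta_\rho(\alpha)|>1$ for infinitely many $\alpha$. Type 4: $|\Delta_\rho(\alpha)|=1$ for all but finitely many $\alpha$. Type 3a: type 3 and there are sequences $(\alpha_i)_{i\in\omega}$, $(\beta_i)_{i\in\omega}$ each consisting of distinct elements with $\alpha_i\ne\beta_i$ and $(\alpha_i,\beta_i)\in\rho$ for all $i$. Type 3b: type 3 and there is a finite $\Gamma\subseteq\Omega$ with $\Delta_\rho(\alpha)\subseteq\Gamma\cup\{\alpha\}$ for all but finitely many $\alpha$. (Every preorder is of exactly one of types 1, 2, 3a, 3b, 4.) $\langle X\rangle$ is the generated submonoid; $M_1\approx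 M_2$ means there exist finite $U,V\subseteq E$ with $M_1\subseteq\langle M_2\cup U\rangle$ and $M_2\subseteq\langle M_1\cup V\rangle$.
   Formalization: In type 2, "no common finite upper bound" is required of the cardinalities of the finite sets Δ_ρ(α) only; counting the finitely many infinite ones too would let a preorder be of types 2 and 4 at once and make the claim false. *)

theory Defs
  imports Main "HOL-Library.Countable_Set"
begin

text \<open>
  The ground set is the universe of a type \<open>'a\<close>, so the monoid of its self-maps is the full
  type \<open>'a \<Rightarrow> 'a\<close>. The product of \<open>f\<close> and \<open>g\<close>, in this order, is \<open>g \<circ> f\<close> (maps act on the right).
\<close>

inductive_set gen_submonoid :: "('a \<Rightarrow> 'a) set \<Rightarrow> ('a \<Rightarrow> 'a) set"
  for X :: "('a \<Rightarrow> 'a) set"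
where
  one: "id \<in> gen_submonoid X"
| base: "f \<in> X \<Longrightarrow> f \<in> gen_submonoid X"
| mult: "f \<in> gen_submonoid X \<Longrightarrow> g \<in> gen_submonoid X \<Longrightarrow> g \<circ> f \<in> gen_submonoid X"

definition fin_gen_equiv :: "('a \<Rightarrow> 'a) set \<Rightarrow> ('a \<Rightarrow> 'a) set \<Rightarrow> bool"  (infix "\<approx>\<^sub>E" 50)
  where "M \<approx>\<^sub>E N \<longleftrightarrow>
    (\<exists>U V. finite U \<and> finite V \<and> M \<subseteq> gen_submonoid (N \<union> U) \<and> N \<subseteq> gen_submonoid (M \<union> V))"

definition selfmaps :: "'a rel \<Rightarrow> ('a \<Rightarrow> 'a) set"
  where "selfmaps \<rho> = {f. \<forall>\<alpha>. (\<alpha>, f \<alpha>) \<in> \<rho>}"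

definition up :: "'a rel \<Rightarrow> 'a \<Rightarrow> 'a set"
  where "up \<rho> \<alpha> = {\<beta>. (\<alpha>, \<beta>) \<in> \<rho>}"

text \<open>As \<open>card\<close> is 0 on infinite sets, cardinality bounds carry an explicit finiteness condition.\<close>

definition card_atmost :: "'a set \<Rightarrow> nat \<Rightarrow> bool"
  where "card_atmost A n \<longleftrightarrow> finite A \<and> card A \<le> n"

definition type1 :: "'a rel \<Rightarrow> bool"
  where "type1 \<rho> \<longleftrightarrow> (\<exists>\<Gamma>. infinite \<Gamma> \<and> (\<forall>\<alpha>\<in>\<Gamma>. infinite (up \<rho> \<alpha>)))"

text \<open>
  The absence of a common finite bound in type 2 refers to those \<open>up \<rho> \<alpha>\<close> that are finite: the
  finitely many infinite ones must not by themselves witness unboundedness. Otherwise type 2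
  would overlap with types 3 and 4, e.g.\ for a preorder that relates a single point to all
  points and every other point only to itself.
\<close>

definition type2 :: "'a rel \<Rightarrow> bool"
  where "type2 \<rho> \<longleftrightarrow>
    \<not> (\<exists>n. \<forall>\<alpha>. finite (up \<rho> \<alpha>) \<longrightarrow> card (up \<rho> \<alpha>) \<le> n) \<and> finite {\<alpha>. infinite (up \<rho> \<alpha>)}"

definition type3 :: "'a rel \<Rightarrow> bool"
  where "type3 \<rho> \<longleftrightarrow>
    (\<exists>n. finite {\<alpha>. \<not> card_atmost (up \<rho> \<alpha>) n}) \<and> infinite {\<alpha>. \<not> card_atmost (up \<rho> \<alpha>) 1}"

definition type3a :: "'a rel \<Rightarrow> bool"
  where "type3a \<rho> \<longleftrightarrow> type3 \<rho> \<and>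
    (\<exists>a b :: nat \<Rightarrow> 'a. inj a \<and> inj b \<and> (\<forall>i. a i \<noteq> b i \<and> (a i, b i) \<in> \<rho>))"

definition type3b :: "'a rel \<Rightarrow> bool"
  where "type3b \<rho> \<longleftrightarrow> type3 \<rho> \<and>
    (\<exists>\<Gamma>. finite \<Gamma> \<and> finite {\<alpha>. \<not> up \<rho> \<alpha> \<subseteq> \<Gamma> \<union> {\<alpha>}})"

definition type4 :: "'a rel \<Rightarrow> bool"
  where "type4 \<rho> \<longleftrightarrow> finite {\<alpha>. card (up \<rho> \<alpha>) \<noteq> 1}"

definition same_type :: "'a rel \<Rightarrow> 'a rel \<Rightarrow> bool"
  where "same_type \<rho> \<rho>' \<longleftrightarrow>
    type1 \<rho> \<and> type1 \<rho>' \<or> type2 \<rho> \<and> type2 \<rho>' \<or> type3a \<rho> \<and> type3a \<rho>' \<or>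
    type3b \<rho> \<and> type3b \<rho>' \<or> type4 \<rho> \<and> type4 \<rho>'"

end

theory Submission
  imports Defs "HOL-Library.FuncSet"
begin

text \<open>
  By Sierpinski's theorem every countable set of self-maps lies in a finitely generated monoid, so
  \<open>M \<approx>\<^sub>E N\<close> holds iff each of \<open>M\<close>, \<open>N\<close> lies in the monoid generated by the other one and
  countably many further maps. The monoid \<open>E(\<rho>)\<close> is the set \<open>Pi UNIV (up \<rho>)\<close> of selections of the
  set-valued map \<open>up \<rho>\<close>.

  For equal types, a selection \<open>f\<close> of \<open>up \<rho>\<close> is written as \<open>v \<circ> g \<circ> u\<close>: an injection \<open>u\<close> sends the
  points to places where \<open>up \<rho>'\<close> is large, \<open>g \<in> E(\<rho>')\<close> selects a code for \<open>f \<alpha>\<close>, and \<open>v\<close> decodes.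
  Finitely many exceptional points only cost countably many choices of \<open>v\<close>. For different types, each
  element of the monoid generated by the smaller \<open>E(\<rho>')\<close> and countably many maps is a selection of
  one of countably many relations whose values are, for \<open>\<rho>'\<close> of type 2, 3, 3b and 4 respectively,
  finite, boundedly finite, a point together with a fixed finite set, and a single point; a diagonal
  argument gives an element of \<open>E(\<rho>)\<close> which is not of this kind.
\<close>

subsection \<open>Countable generation\<close>

lemma gen_submonoid_least:
  assumes "X \<subseteq> gen_submonoid Y"
  shows "gen_submonoid X \<subseteq> gen_submonoid Y"
proof
  fix f assume "f \<in> gen_submonoid X"
  then show "f \<in> gen_submonoid Y"
    by induction (use assms in \<open>blast intro: gen_submonoid.intros\<close>)+
qed

lemma gen_submonoid_mono: "X \<subseteq> Y \<Longrightarrow> gen_submonoid X \<subseteq> gen_submonoid Y"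
  by (intro gen_submonoid_least) (auto intro: gen_submonoid.base)

lemma gen_submonoid_funpow: "f \<in> gen_submonoid X \<Longrightarrow> f ^^ n \<in> gen_submonoid X"
proof (induction n)
  case 0
  show ?case unfolding funpow_0 id_def[symmetric] funpow.simps by (rule gen_submonoid.one)
next
  case (Suc n)
  then show ?case unfolding funpow.simps by (blast intro: gen_submonoid.mult)
qed

lemma ex_inj_prod:
  assumes "infinite (UNIV :: 'a set)" "countable (UNIV :: 'a set)"
    and "countable (UNIV :: 'i set)" "countable (UNIV :: 'j set)"
  obtains c :: "'i \<times> 'j \<Rightarrow> 'a" where "inj c"
proof -
  have "bij (from_nat_into (UNIV :: 'a set))"
    using assms(1,2) bij_betw_from_nat_into by blast
  moreover have "inj (to_nat_on (UNIV :: ('i \<times> 'j) set))"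
    using assms(3,4) by (metis UNIV_Times_UNIV countable_SIGMA inj_on_to_nat_on)
  ultimately show thesis
    using that[of "from_nat_into UNIV \<circ> to_nat_on UNIV"] by (simp add: bij_def inj_compose)
qed

lemma ex_inj_pair:
  assumes "infinite (UNIV :: 'a set)" "countable (UNIV :: 'a set)"
  obtains l r :: "'a \<Rightarrow> 'a" where "inj l" "inj r" "\<And>x y. l x \<noteq> r y"
proof -
  have "countable (UNIV :: bool set)" by simp
  then obtain c :: "bool \<times> 'a \<Rightarrow> 'a" where "inj c"
    using ex_inj_prod[of thesis] assms by blast
  then show thesis
    using that[of "\<lambda>x. c (True, x)" "\<lambda>x. c (False, x)"] by (auto simp: inj_def)
qed

text \<open>Sierpinski's theorem by Banach's argument: after embedding \<open>\<nat> \<times> \<Omega>\<close> into \<open>\<Omega>\<close>, one map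
  acts on the \<open>n\<close>-th copy of \<open>\<Omega>\<close> as the \<open>n\<close>-th given map, and a shift reaches that copy.\<close>

lemma countable_subset_finitely_generated:
  fixes C :: "('a \<Rightarrow> 'a) set"
  assumes "infinite (UNIV :: 'a set)" "countable (UNIV :: 'a set)" "countable C"
  obtains U where "finite U" "C \<subseteq> gen_submonoid U"
proof -
  have "countable (UNIV :: nat set)" by simp
  then obtain c :: "nat \<times> 'a \<Rightarrow> 'a" where c: "inj c"
    using ex_inj_prod[of thesis] assms by blast
  define i where "i = (\<lambda>x. c (0, x))"
  define s where "s = (\<lambda>y. c (map_prod Suc id (inv c y)))"
  define \<phi> where "\<phi> = (\<lambda>y. case inv c y of (n, x) \<Rightarrow> from_nat_into C n x)"
  have sn: "(s ^^ n) (i x) = c (n, x)" for n x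
    by (induction n) (use c in \<open>auto simp: s_def i_def\<close>)
  have "f \<in> gen_submonoid {i, s, \<phi>}" if f: "f \<in> C" for f
  proof -
    obtain n where "f = from_nat_into C n"
      using from_nat_into_surj[OF assms(3) f] by blast
    then have "f = \<phi> \<circ> ((s ^^ n) \<circ> i)"
      using c by (auto simp: \<phi>_def sn)
    moreover have "s ^^ n \<in> gen_submonoid {i, s, \<phi>}"
      by (intro gen_submonoid_funpow gen_submonoid.base) simp
    ultimately show ?thesis
      by (auto intro: gen_submonoid.base intro!: gen_submonoid.mult)
  qed
  then show thesis using that[of "{i, s, \<phi>}"] by blast
qed

text \<open>By Sierpinski's theorem countably many extra generators are as good as finitely many.
  Working with a countable set lets the decoding maps below depend on the values of the coded map at
  finitely many points.\<close>

definition countably_below :: "('a \<Rightarrow> 'a) set \<Rightarrow> ('a \<Rightarrow> 'a) set \<Rightarrow> bool"  (infix "\<preceq>" 50)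
  where "M \<preceq> N \<longleftrightarrow> (\<exists>C. countable C \<and> M \<subseteq> gen_submonoid (N \<union> C))"

lemma fin_gen_equiv_iff:
  fixes M N :: "('a \<Rightarrow> 'a) set"
  assumes "infinite (UNIV :: 'a set)" "countable (UNIV :: 'a set)"
  shows "M \<approx>\<^sub>E N \<longleftrightarrow> M \<preceq> N \<and> N \<preceq> M"
proof -
  have "K \<preceq> L \<longleftrightarrow> (\<exists>U. finite U \<and> K \<subseteq> gen_submonoid (L \<union> U))" for K L :: "('a \<Rightarrow> 'a) set"
  proof
    assume "K \<preceq> L"
    then obtain C where C: "countable C" "K \<subseteq> gen_submonoid (L \<union> C)"
      by (auto simp: countably_below_def)
    obtain U where U: "finite U" "C \<subseteq> gen_submonoid U"
      using countable_subset_finitely_generated[OF assms C(1)] by blast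
    have "gen_submonoid (L \<union> C) \<subseteq> gen_submonoid (L \<union> U)"
      using U(2) gen_submonoid_mono[of U "L \<union> U"]
      by (intro gen_submonoid_least) (auto intro: gen_submonoid.base)
    then show "\<exists>U. finite U \<and> K \<subseteq> gen_submonoid (L \<union> U)" using C U by blast
  qed (auto simp: countably_below_def intro: countable_finite)
  then show ?thesis by (auto simp: fin_gen_equiv_def)
qed

lemma countably_below_subset: "M \<subseteq> N \<Longrightarrow> M \<preceq> N"
  unfolding countably_below_def by (rule exI[of _ "{}"]) (auto intro: gen_submonoid.base)

text \<open>The outer maps play different parts: \<open>u\<close> is the same for all
  \<open>f\<close>, while \<open>v\<close> may vary with \<open>f\<close> inside a countable set.
  Two middle factors allow a selection to be made in two stages.\<close>

lemma countably_below_factor2: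
  assumes "N1 \<preceq> M" "N2 \<preceq> M" "countable C"
    and fac: "\<And>f. f \<in> L \<Longrightarrow> \<exists>g\<in>N1. \<exists>h\<in>N2. \<exists>v\<in>C. f = v \<circ> h \<circ> g \<circ> u"
  shows "L \<preceq> M"
proof -
  obtain C1 where C1: "countable C1" "N1 \<subseteq> gen_submonoid (M \<union> C1)"
    using assms(1) by (auto simp: countably_below_def)
  obtain C2 where C2: "countable C2" "N2 \<subseteq> gen_submonoid (M \<union> C2)"
    using assms(2) by (auto simp: countably_below_def)
  define D where "D = insert u (C \<union> C1 \<union> C2)"
  have sub: "N1 \<subseteq> gen_submonoid (M \<union> D)" "N2 \<subseteq> gen_submonoid (M \<union> D)"
    using C1(2) C2(2) gen_submonoid_mono[of "M \<union> C1" "M \<union> D"]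
      gen_submonoid_mono[of "M \<union> C2" "M \<union> D"] by (auto simp: D_def)
  have "L \<subseteq> gen_submonoid (M \<union> D)"
  proof
    fix f assume "f \<in> L"
    then obtain g h v where "g \<in> N1" "h \<in> N2" "v \<in> C" and f: "f = v \<circ> h \<circ> g \<circ> u"
      using fac by blast
    moreover have "w \<in> gen_submonoid (M \<union> D)" if "w = u \<or> w \<in> C" for w
      using that by (auto simp: D_def intro: gen_submonoid.base)
    ultimately show "f \<in> gen_submonoid (M \<union> D)"
      unfolding f by (intro gen_submonoid.mult) (use sub in auto)
  qed
  moreover have "countable D" using C1 C2 assms(3) by (simp add: D_def)
  ultimately show ?thesis by (auto simp: countably_below_def)
qed

lemma countably_below_factor:
  assumes "N \<preceq> M" "countable C" "\<And>f. f \<in> L \<Longrightarrow> \<exists>g\<in>N. \<exists>v\<in>C. f = v \<circ> g \<circ> u"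
  shows "L \<preceq> M"
proof (rule countably_below_factor2[OF assms(1) _ assms(2), of "{id}"])
  show "{id} \<preceq> M"
    unfolding countably_below_def by (rule exI[of _ "{}"]) (auto intro: gen_submonoid.one)
qed (use assms(3) in auto)

subsection \<open>Selections of large families\<close>

lemma selfmaps_eq_Pi: "selfmaps \<rho> = Pi UNIV (up \<rho>)"
  by (auto simp: selfmaps_def up_def Pi_def)

text \<open>Association lists over a countable type are countable, and one of them records the
  values of \<open>f\<close> on \<open>S\<close>. What its map does elsewhere is arbitrary.\<close>

lemma countable_dense_on_finite:
  assumes "finite S" "countable (UNIV :: 'a set)"
  obtains P :: "('a \<Rightarrow> 'a) set" where "countable P" "\<And>f. \<exists>p\<in>P. \<forall>s\<in>S. p s = f s"
proof
  have "countable (UNIV :: ('a \<times> 'a) set)"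
    using assms(2) by (metis UNIV_Times_UNIV countable_SIGMA)
  then have "countable (UNIV :: ('a \<times> 'a) list set)"
    by (metis countable_lists lists_UNIV)
  then show "countable (range (\<lambda>xs :: ('a \<times> 'a) list. the \<circ> map_of xs))"
    by (rule countable_image)
  fix f :: "'a \<Rightarrow> 'a"
  obtain ks where ks: "set ks = S" using finite_list[OF assms(1)] by blast
  have "the (map_of (map (\<lambda>k. (k, f k)) ks) s) = f s" if "s \<in> S" for s
    using that ks by (simp add: map_of_map_restrict)
  then show "\<exists>p\<in>range (\<lambda>xs. the \<circ> map_of xs). \<forall>s\<in>S. p s = f s"
    by (auto intro!: exI[of _ "map (\<lambda>k. (k, f k)) ks"])
qed

text \<open>Run through an enumeration of the indices: at each stage only finitely many finite
  supports have been used, so \<open>ex\<close> offers a fresh object.\<close>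

lemma greedy_choice:
  fixes P :: "'i \<Rightarrow> 'b \<Rightarrow> bool" and supp :: "'b \<Rightarrow> 'a set"
  assumes "countable (UNIV :: 'i set)"
    and fin: "\<And>i y. P i y \<Longrightarrow> finite (supp y)"
    and ex: "\<And>i F. finite F \<Longrightarrow> \<exists>y. P i y \<and> supp y \<inter> F = {}"
  obtains s where "\<And>i. P i (s i)" "\<And>i j. i \<noteq> j \<Longrightarrow> supp (s i) \<inter> supp (s j) = {}"
proof -
  define Q where "Q t n y \<longleftrightarrow> P (from_nat_into UNIV n) y \<and> supp y \<inter> (\<Union>m<n. supp (t m)) = {}"
    for t n y
  have "\<exists>t. \<forall>n. Q t n (t n)"
  proof (rule dependent_wellorder_choice)
    fix n t assume "\<And>m. m < n \<Longrightarrow> Q t m (t m)"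
    then have "finite (\<Union>m<n. supp (t m))" by (auto simp: Q_def intro!: fin)
    then show "\<exists>y. Q t n y" using ex by (auto simp: Q_def)
  qed (auto simp: Q_def)
  then obtain t where t: "\<And>n. Q t n (t n)" by blast
  have disj: "supp (t m) \<inter> supp (t n) = {}" if "m \<noteq> n" for m n
    using t[of m] t[of n] that unfolding Q_def by (cases "m < n") (auto simp: not_less_iff_gr_or_eq)
  \<comment> \<open>The sequence \<open>t\<close> is indexed by natural numbers, and for a finite
    index type \<open>from_nat_into\<close> repeats indices. The injection \<open>e\<close> picks
    one position of \<open>t\<close> for each index.\<close>
  define e where "e = to_nat_on (UNIV :: 'i set)"
  have "inj e" unfolding e_def using assms(1) by (rule inj_on_to_nat_on)
  show thesis
  proof (rule that[of "t \<circ> e"])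
    fix i
    show "P i ((t \<circ> e) i)" using t[of "e i"] assms(1) by (simp add: Q_def e_def)
    fix j assume "i \<noteq> j"
    then show "supp ((t \<circ> e) i) \<inter> supp ((t \<circ> e) j) = {}"
      using \<open>inj e\<close> by (auto simp: inj_def dest: disj)
  qed
qed

lemma ex_inj_choice:
  fixes Y :: "'i \<Rightarrow> 'a set"
  assumes "countable (UNIV :: 'i set)" "\<And>i. infinite (Y i)"
  obtains x where "inj x" "\<And>i. x i \<in> Y i"
proof -
  obtain x where "\<And>i. x i \<in> Y i" "\<And>i j. i \<noteq> j \<Longrightarrow> {x i} \<inter> {x j} = {}"
  proof (rule greedy_choice[of "\<lambda>i y. y \<in> Y i" "\<lambda>y. {y}", OF assms(1)])
    fix i and F :: "'a set" assume "finite F"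
    then show "\<exists>y. y \<in> Y i \<and> {y} \<inter> F = {}"
      using infinite_imp_nonempty[OF Diff_infinite_finite[OF _ assms(2)[of i]]] by auto
  qed auto
  then show thesis using that[of x] by (force simp: inj_def)
qed

section \<open>Reducing one family of selections to another\<close>

lemma Pi_below_if_coded:
  fixes A B :: "'a \<Rightarrow> 'a set"
  assumes refl: "\<And>y. y \<in> B y" and u: "inj u" and x: "inj_on x (Sigma UNIV A)"
    and xB: "\<And>\<alpha> \<beta>. \<beta> \<in> A \<alpha> \<Longrightarrow> x (\<alpha>, \<beta>) \<in> B (u \<alpha>)"
  shows "Pi UNIV A \<preceq> Pi UNIV B"
proof (rule countably_below_factor[OF countably_below_subset[OF order_refl]])
  define v where "v y = snd (inv_into (Sigma UNIV A) x y)" for y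
  show "countable {v}" by simp
  fix f assume f: "f \<in> Pi UNIV A"
  \<comment> \<open>At \<open>u \<alpha>\<close>, \<open>g\<close> writes the code of the pair of
    \<alpha> and \<open>f \<alpha>\<close>. The code determines the pair, so \<open>v\<close>
    recovers the value without knowing \<alpha> and serves all \<open>f\<close> at once.\<close>
  define g where "g y = (if y \<in> range u then x (inv u y, f (inv u y)) else y)" for y
  have "g \<in> Pi UNIV B" using f u refl by (auto simp: g_def Pi_iff intro!: xB)
  moreover have "f \<alpha> = (v \<circ> g \<circ> u) \<alpha>" for \<alpha>
  proof -
    have "(\<alpha>, f \<alpha>) \<in> Sigma UNIV A" using f by auto
    then show ?thesis using u x by (simp add: g_def v_def inv_into_f_f)
  qed
  ultimately show "\<exists>g\<in>Pi UNIV B. \<exists>v\<in>{v}. f = v \<circ> g \<circ> u" by blast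
qed

text \<open>Greedy choice gives the points \<alpha> pairwise disjoint finite blocks, each large
  enough to hold codes for \<open>A \<alpha>\<close>. Disjointness makes a code reveal its \<alpha>.
  The point \<gamma> joins the support so that the positions become distinct as well.\<close>

lemma Pi_below_if_finite_blocks:
  fixes A B :: "'a \<Rightarrow> 'a set"
  assumes "countable (UNIV :: 'a set)" and refl: "\<And>y. y \<in> B y" and finA: "\<And>\<alpha>. finite (A \<alpha>)"
    and ex: "\<And>\<alpha> F. finite F \<Longrightarrow>
      \<exists>\<gamma> X. \<gamma> \<notin> F \<and> X \<inter> F = {} \<and> finite X \<and> X \<subseteq> B \<gamma> \<and> card (A \<alpha>) \<le> card X"
  shows "Pi UNIV A \<preceq> Pi UNIV B"
proof -
  define P where "P \<alpha> y \<longleftrightarrow> finite (snd y) \<and> snd y \<subseteq> B (fst y) \<and> card (A \<alpha>) \<le> card (snd y)"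
    for \<alpha> and y :: "'a \<times> 'a set"
  obtain s where P: "\<And>\<alpha>. P \<alpha> (s \<alpha>)" and disj: "\<And>\<alpha> \<beta>. \<alpha> \<noteq> \<beta> \<Longrightarrow>
      insert (fst (s \<alpha>)) (snd (s \<alpha>)) \<inter> insert (fst (s \<beta>)) (snd (s \<beta>)) = {}"
  proof (rule greedy_choice[of P "\<lambda>y. insert (fst y) (snd y)"])
    fix \<alpha> and F :: "'a set" assume "finite F"
    then obtain \<gamma> X where "\<gamma> \<notin> F" "X \<inter> F = {}" "P \<alpha> (\<gamma>, X)"
      using ex[of F \<alpha>] by (auto simp: P_def)
    then show "\<exists>y. P \<alpha> y \<and> insert (fst y) (snd y) \<inter> F = {}"
      by (intro exI[of _ "(\<gamma>, X)"]) auto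
  qed (use assms(1) in \<open>auto simp: P_def\<close>)
  have "\<exists>\<phi>. inj_on \<phi> (A \<alpha>) \<and> \<phi> ` A \<alpha> \<subseteq> snd (s \<alpha>)" for \<alpha>
    using P[of \<alpha>] inj_on_iff_card_le[OF finA] unfolding P_def by blast
  then obtain \<phi> where \<phi>: "\<And>\<alpha>. inj_on (\<phi> \<alpha>) (A \<alpha>)" "\<And>\<alpha>. \<phi> \<alpha> ` A \<alpha> \<subseteq> snd (s \<alpha>)"
    by metis
  show ?thesis
  proof (rule Pi_below_if_coded[OF refl, of "fst \<circ> s" "\<lambda>(\<alpha>, \<beta>). \<phi> \<alpha> \<beta>"])
    show "inj (fst \<circ> s)" using disj by (fastforce simp: inj_def)
    show "inj_on (\<lambda>(\<alpha>, \<beta>). \<phi> \<alpha> \<beta>) (Sigma UNIV A)"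
    proof (rule inj_onI, clarsimp)
      fix \<alpha> \<beta> \<alpha>' \<beta>' assume *: "\<beta> \<in> A \<alpha>" "\<beta>' \<in> A \<alpha>'" "\<phi> \<alpha> \<beta> = \<phi> \<alpha>' \<beta>'"
      then have "\<phi> \<alpha> \<beta> \<in> snd (s \<alpha>) \<inter> snd (s \<alpha>')" using \<phi>(2) by fastforce
      then have "\<alpha> = \<alpha>'" using disj[of \<alpha> \<alpha>'] by blast
      then show "\<alpha> = \<alpha>' \<and> \<beta> = \<beta>'" using * \<phi>(1) by (auto dest: inj_onD)
    qed
    show "(case (\<alpha>, \<beta>) of (\<alpha>, \<beta>) \<Rightarrow> \<phi> \<alpha> \<beta>) \<in> B ((fst \<circ> s) \<alpha>)" if "\<beta> \<in> A \<alpha>" for \<alpha> \<beta>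
      using that \<phi>(2)[of \<alpha>] P[of \<alpha>] by (auto simp: P_def)
  qed
qed

text \<open>Infinite sets never run out of fresh codes: after an injection \<open>u\<close> into
  \<Gamma>, distinct codes are chosen for all pairs at once, the code of a pair with first entry
  \<alpha> lying in \<open>B (u \<alpha>)\<close>.\<close>

lemma Pi_below_if_infinitely_many_infinite:
  fixes A B :: "'a \<Rightarrow> 'a set"
  assumes "countable (UNIV :: 'a set)" and refl: "\<And>y. y \<in> B y"
    and \<Gamma>: "infinite \<Gamma>" "\<And>\<gamma>. \<gamma> \<in> \<Gamma> \<Longrightarrow> infinite (B \<gamma>)"
  shows "Pi UNIV A \<preceq> Pi UNIV B"
proof -
  obtain u :: "'a \<Rightarrow> 'a" where u: "inj u" "\<And>\<alpha>. u \<alpha> \<in> \<Gamma>"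
    using ex_inj_choice[of "\<lambda>_. \<Gamma>"] assms(1) \<Gamma>(1) by blast
  have "countable (UNIV :: ('a \<times> 'a) set)"
    using assms(1) by (metis UNIV_Times_UNIV countable_SIGMA)
  then obtain x :: "'a \<times> 'a \<Rightarrow> 'a" where "inj x" "\<And>i. x i \<in> B (u (fst i))"
    using ex_inj_choice[of "\<lambda>i :: 'a \<times> 'a. B (u (fst i))"] \<Gamma>(2) u(2) by blast
  then show ?thesis
    using Pi_below_if_coded[OF refl u(1), where x = x] by (metis fst_conv inj_on_subset subset_UNIV)
qed

text \<open>Points outside \<open>S\<close> are moved to the left copy and treated there; points of \<open>S\<close> wait in the
  right copy for the last map, which sends them to one of countably many possible value patterns.\<close>

lemma Pi_below_without_exceptions:
  fixes A :: "'a \<Rightarrow> 'a set" and l r :: "'a \<Rightarrow> 'a"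
  assumes "countable (UNIV :: 'a set)" "finite S" and lr: "inj l" "inj r" "\<And>x y. l x \<noteq> r y"
    and below: "Pi UNIV (\<lambda>x. if x \<in> l ` (- S) then l ` A (inv l x) else {x}) \<preceq> M"
  shows "Pi UNIV A \<preceq> M"
proof -
  obtain P :: "('a \<Rightarrow> 'a) set" where P: "countable P" "\<And>f. \<exists>p\<in>P. \<forall>s\<in>S. p s = f s"
    using countable_dense_on_finite assms(1,2) by blast
  define v where "v p x = (if x \<in> range l then inv l x else p (inv r x))" for p x
  define u where "u x = (if x \<in> S then r x else l x)" for x
  show ?thesis
  proof (rule countably_below_factor[OF below, of "v ` P"])
    show "countable (v ` P)" using P(1) by simp
    fix f assume f: "f \<in> Pi UNIV A"
    obtain p where p: "p \<in> P" "\<And>s. s \<in> S \<Longrightarrow> p s = f s" using P(2) by blast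
    define g where "g x = (if x \<in> l ` (- S) then l (f (inv l x)) else x)" for x
    have "g \<in> Pi UNIV (\<lambda>x. if x \<in> l ` (- S) then l ` A (inv l x) else {x})"
      using f lr(1) by (auto simp: g_def Pi_iff)
    moreover have "f = v p \<circ> g \<circ> u"
    proof
      fix x show "f x = (v p \<circ> g \<circ> u) x"
        using lr p(2) lr(3)[symmetric] by (cases "x \<in> S") (auto simp: g_def u_def v_def)
    qed
    ultimately show "\<exists>g\<in>Pi UNIV (\<lambda>x. if x \<in> l ` (- S) then l ` A (inv l x) else {x}).
        \<exists>w\<in>v ` P. f = w \<circ> g \<circ> u" using p(1) by blast
  qed
qed

text \<open>The bound is lowered by one at the cost of a binary choice, namely whether \<open>f x\<close> is a
  distinguished element \<open>c x\<close> of \<open>A x\<close>.\<close>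

lemma Pi_below_if_bounded:
  fixes A :: "'a \<Rightarrow> 'a set"
  assumes inf: "infinite (UNIV :: 'a set)" and cnt: "countable (UNIV :: 'a set)"
    and two: "\<And>B :: 'a \<Rightarrow> 'a set. (\<And>x. card_atmost (B x) 2) \<Longrightarrow> Pi UNIV B \<preceq> M"
    and "\<And>x. card_atmost (A x) n"
  shows "Pi UNIV A \<preceq> M"
  using assms(4)
proof (induction n arbitrary: A)
  case 0
  have "card_atmost (A x) 2" for x
    using 0[of x] by (simp add: card_atmost_def)
  then show ?case by (rule two)
next
  case (Suc n)
  show ?case
  proof (cases "n < 2")
    case True
    have "card_atmost (A x) 2" for x
      using Suc.prems[of x] True by (auto simp: card_atmost_def)
    then show ?thesis by (rule two)
  next
    case False
    obtain l r :: "'a \<Rightarrow> 'a" where lr: "inj l" "inj r" "\<And>x y. l x \<noteq> r y"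
      using ex_inj_pair[OF inf cnt] by blast
    note lr' = lr(3)[symmetric]
    define c where "c x = (SOME y. y \<in> A x)" for x
    \<comment> \<open>Stage one, a selection of \<open>B\<close>, moves \<open>l x\<close> to
      \<open>r x\<close> if \<open>f x\<close> is \<open>c x\<close> and keeps it otherwise. Stage
      two, a selection of \<open>D\<close>, sends \<open>r x\<close> to \<open>c x\<close> and
      \<open>l x\<close> to one of the remaining values.\<close>
    define B where "B x = (if x \<in> range l then {x, r (inv l x)} else {x})" for x
    \<comment> \<open>When no value remains, the default \<open>{c x}\<close> keeps the set
      nonempty, so that \<open>h\<close> has a value to take there.\<close>
    define A' where "A' x = (if A x \<subseteq> {c x} then {c x} else A x - {c x})" for x
    define D where "D x = (if x \<in> range l then A' (inv l x)
      else if x \<in> range r then {c (inv r x)} else {x})" for x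
    have B: "Pi UNIV B \<preceq> M" by (intro two) (auto simp: B_def card_atmost_def card_insert_if)
    have D: "Pi UNIV D \<preceq> M"
    proof (rule Suc.IH)
      have A': "card_atmost (A' x) n" for x
      proof (cases "A x \<subseteq> {c x}")
        case True
        then show ?thesis using False by (simp add: A'_def card_atmost_def)
      next
        case *: False
        then have "c x \<in> A x" unfolding c_def by (auto intro: someI)
        then show ?thesis using * Suc.prems[of x] by (auto simp: A'_def card_atmost_def)
      qed
      show "card_atmost (D x) n" for x
        using False A' by (auto simp: D_def card_atmost_def)
    qed
    show ?thesis
    proof (rule countably_below_factor2[OF B D, of "{id}" _ l])
      fix f assume f: "f \<in> Pi UNIV A"
      define g where "g x = (if x \<in> range l \<and> f (inv l x) = c (inv l x) then r (inv l x) else x)" for x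
      define h where "h x = (if x \<in> range l then
          if f (inv l x) \<in> A' (inv l x) then f (inv l x) else (SOME y. y \<in> A' (inv l x))
        else if x \<in> range r then c (inv r x) else x)" for x
      have "g \<in> Pi UNIV B" by (auto simp: g_def B_def)
      moreover have "(SOME y. y \<in> A' x) \<in> A' x" for x
        by (rule someI_ex) (auto simp: A'_def)
      then have "h \<in> Pi UNIV D" using lr lr' by (auto simp: h_def D_def)
      moreover have "f = id \<circ> h \<circ> g \<circ> l"
      proof
        fix x
        have "f x \<in> A x" using f by auto
        then have "f x \<in> A' x" if "f x \<noteq> c x" using that by (auto simp: A'_def)
        then show "f x = (id \<circ> h \<circ> g \<circ> l) x"
          using lr lr' by (auto simp: g_def h_def)
      qed
      ultimately show "\<exists>g\<in>Pi UNIV B. \<exists>h\<in>Pi UNIV D. \<exists>v\<in>{id}. f = v \<circ> h \<circ> g \<circ> l" by blast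
    qed simp
  qed
qed

text \<open>Targets are split off one at a time. The point \<open>l x\<close> first jumps to the
  marker \<open>r \<gamma>\<close> if \<open>f x\<close> is \<gamma>, and otherwise is handled
  inside the left copy with the remaining targets; \<open>v\<close> undoes \<open>l\<close> and
  reads the marker as \<gamma>.\<close>

lemma Pi_below_if_finite_targets:
  fixes \<Gamma> :: "'a set"
  assumes inf: "infinite (UNIV :: 'a set)" and cnt: "countable (UNIV :: 'a set)"
    and one: "\<And>\<gamma>. Pi UNIV (\<lambda>x :: 'a. {x, \<gamma>}) \<preceq> M"
    and "finite \<Gamma>"
  shows "Pi UNIV (\<lambda>x. insert x \<Gamma>) \<preceq> M"
  using assms(4)
proof (induction "card \<Gamma>" arbitrary: \<Gamma>)
  case 0
  \<comment> \<open>Without targets the identity is the only selection, and an arbitrary target,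
    here \<open>undefined\<close>, may be added.\<close>
  have "Pi UNIV (\<lambda>x. insert x \<Gamma>) \<subseteq> Pi UNIV (\<lambda>x. {x, undefined})" using 0 by auto
  then show ?case
    by (intro countably_below_factor[OF one[of undefined], of "{id}" _ id]) auto
next
  case (Suc n)
  obtain \<gamma> \<Gamma>' where \<Gamma>: "\<Gamma> = insert \<gamma> \<Gamma>'" "n = card \<Gamma>'" "finite \<Gamma>'"
    using Suc.hyps(2) Suc.prems by (metis card_Suc_eq finite_insert)
  obtain l r :: "'a \<Rightarrow> 'a" where lr: "inj l" "inj r" "\<And>x y. l x \<noteq> r y"
    using ex_inj_pair[OF inf cnt] by blast
  note lr' = lr(3)[symmetric]
  have D: "Pi UNIV (\<lambda>x. insert x (l ` \<Gamma>')) \<preceq> M"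
    using \<Gamma> lr(1) by (intro Suc.hyps(1)) (auto simp: card_image inj_on_subset)
  define v where "v x = (if x \<in> range l then inv l x else \<gamma>)" for x
  show ?case
  proof (rule countably_below_factor2[OF one[of "r \<gamma>"] D, of "{v}" _ l])
    fix f assume f: "f \<in> Pi UNIV (\<lambda>x. insert x \<Gamma>)"
    define g where "g x = (if x \<in> range l \<and> f (inv l x) = \<gamma> then r \<gamma> else x)" for x
    define h where "h x = (if x \<in> range l \<and> f (inv l x) \<noteq> \<gamma> then l (f (inv l x)) else x)" for x
    have "g \<in> Pi UNIV (\<lambda>x. {x, r \<gamma>})" by (auto simp: g_def)
    moreover have "h \<in> Pi UNIV (\<lambda>x. insert x (l ` \<Gamma>'))"
      using f lr(1) \<Gamma>(1) by (fastforce simp: h_def Pi_iff)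
    moreover have "f = v \<circ> h \<circ> g \<circ> l"
      by (rule ext) (use lr lr' in \<open>auto simp: g_def h_def v_def\<close>)
    ultimately show "\<exists>g\<in>Pi UNIV (\<lambda>x. {x, r \<gamma>}). \<exists>h\<in>Pi UNIV (\<lambda>x. insert x (l ` \<Gamma>')).
        \<exists>v\<in>{v}. f = v \<circ> h \<circ> g \<circ> l" by blast
  qed simp
qed

text \<open>Staying at \<open>u x\<close> or jumping to the common point \<gamma> encodes the choice
  between \<open>x\<close> and \<gamma>'. All points \<open>u x\<close> differ from \<gamma>, so
  \<open>v\<close> can tell the two outcomes apart.\<close>

lemma Pi_below_if_common_target:
  fixes B :: "'a \<Rightarrow> 'a set"
  assumes cnt: "countable (UNIV :: 'a set)" and refl: "\<And>y. y \<in> B y"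
    and D: "infinite {x. x \<noteq> \<gamma> \<and> \<gamma> \<in> B x}"
  shows "Pi UNIV (\<lambda>x. {x, \<gamma>'}) \<preceq> Pi UNIV B"
proof -
  obtain u :: "'a \<Rightarrow> 'a" where u: "inj u" "\<And>x. u x \<in> {x. x \<noteq> \<gamma> \<and> \<gamma> \<in> B x}"
    using ex_inj_choice[of "\<lambda>_. {x. x \<noteq> \<gamma> \<and> \<gamma> \<in> B x}"] cnt D by blast
  define v where "v x = (if x = \<gamma> then \<gamma>' else inv u x)" for x
  show ?thesis
  proof (rule countably_below_factor[OF countably_below_subset[OF order_refl], of "{v}" _ _ u])
    fix f assume f: "f \<in> Pi UNIV (\<lambda>x. {x, \<gamma>'})"
    define g where "g x = (if x \<in> range u \<and> f (inv u x) = \<gamma>' then \<gamma> else x)" for x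
    have "g \<in> Pi UNIV B" using u refl by (auto simp: g_def)
    moreover have "f x = (v \<circ> g \<circ> u) x" for x
      using f u(1) u(2)[of x] by (auto simp: g_def v_def Pi_iff)
    ultimately show "\<exists>g\<in>Pi UNIV B. \<exists>v\<in>{v}. f = v \<circ> g \<circ> u" by blast
  qed simp
qed

subsection \<open>Separating the types\<close>

text \<open>Lists are used because a countable set of relations has only countably many of them;
  concatenation of lists matches composition of relations, in the order in which the maps
  act.\<close>

lemma gen_submonoid_cover_by_relations:
  assumes "h \<in> gen_submonoid X"
    and X: "\<And>f. f \<in> X \<Longrightarrow> \<exists>R\<in>\<B>. \<forall>x. (x, f x) \<in> R"
  shows "\<exists>Rs\<in>lists \<B>. \<forall>x. (x, h x) \<in> foldr (O) Rs Id"
  using assms(1)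
proof induction
  case one
  show ?case by (intro bexI[of _ "[]"]) auto
next
  case (base f)
  then obtain R where "R \<in> \<B>" "\<forall>x. (x, f x) \<in> R" using X by blast
  then show ?case by (intro bexI[of _ "[R]"]) auto
next
  case (mult f g)
  then obtain Rs Ss where *: "Rs \<in> lists \<B>" "\<forall>x. (x, f x) \<in> foldr (O) Rs Id"
    "Ss \<in> lists \<B>" "\<forall>x. (x, g x) \<in> foldr (O) Ss Id"
    by blast
  have "foldr (O) Rs T = foldr (O) Rs Id O T" for T :: "'a rel"
    by (induction Rs) (auto simp: O_assoc)
  from this[of "foldr (O) Ss Id"]
  have "foldr (O) (Rs @ Ss) Id = foldr (O) Rs Id O foldr (O) Ss Id" unfolding foldr_append comp_def .
  then show ?case using * by (intro bexI[of _ "Rs @ Ss"]) auto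
qed

text \<open>Every element of a monoid countably generated over \<open>Pi UNIV B\<close> is a selection of one of
  countably many relations satisfying \<open>Q\<close>; a selection of \<open>A\<close> can be chosen to escape each of
  them at a point of its own.\<close>

lemma not_below_if_escape:
  fixes A B :: "'a \<Rightarrow> 'a set" and Q :: "'a rel \<Rightarrow> bool"
  assumes cnt: "countable (UNIV :: 'a set)" and "finite S"
    and Q_comp: "\<And>R R'. Q R \<Longrightarrow> Q R' \<Longrightarrow> Q (R O R')"
    and Q_fun: "\<And>f. Q {(x, y). y = f x}"
    and Q_B: "\<And>p. Q {(x, y). if x \<in> S then y = p x else y \<in> B x}"
    and esc: "\<And>R. Q R \<Longrightarrow> infinite {x. \<not> A x \<subseteq> R `` {x}}"
    and refl: "\<And>x. x \<in> A x"
  shows "\<not> Pi UNIV A \<preceq> Pi UNIV B"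
proof
  assume "Pi UNIV A \<preceq> Pi UNIV B"
  then obtain C where C: "countable C" "Pi UNIV A \<subseteq> gen_submonoid (Pi UNIV B \<union> C)"
    by (auto simp: countably_below_def)
  obtain P :: "('a \<Rightarrow> 'a) set" where P: "countable P" "\<And>f. \<exists>p\<in>P. \<forall>s\<in>S. p s = f s"
    using countable_dense_on_finite assms(1,2) by blast
  define graph where "graph f = {(x, y). y = f x}" for f :: "'a \<Rightarrow> 'a"
  \<comment> \<open>All elements of \<open>Pi UNIV B\<close> obey the same relation off
    \<open>S\<close>, and on \<open>S\<close> each follows one of the countably many patterns in
    \<open>P\<close>. Prescribing the values on \<open>S\<close> secures \<open>Q\<close> even where
    the sets \<open>B x\<close> are too large.\<close>
  define patch where "patch p = {(x, y). if x \<in> S then y = p x else y \<in> B x}" for p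
  define \<B> where "\<B> = graph ` C \<union> patch ` P"
  define \<R> where "\<R> = (\<lambda>Rs. foldr (O) Rs Id) ` lists \<B>"
  have cnt\<R>: "countable \<R>" using C(1) P(1) by (simp add: \<R>_def \<B>_def)
  have "Id = {(x, y). y = id x}" by auto
  then have "Q Id" using Q_fun[of id] by metis
  moreover have "Q R" if "R \<in> \<B>" for R using that Q_fun Q_B by (auto simp: \<B>_def graph_def patch_def)
  ultimately have "Q (foldr (O) Rs Id)" if "Rs \<in> lists \<B>" for Rs
    using that by (induction Rs) (auto intro: Q_comp)
  then have Q: "Q R" if "R \<in> \<R>" for R using that by (auto simp: \<R>_def)
  have cover: "\<exists>R\<in>\<R>. \<forall>x. (x, f x) \<in> R" if "f \<in> Pi UNIV A" for f
  proof -
    have "\<exists>R\<in>\<B>. \<forall>x. (x, g x) \<in> R" if g: "g \<in> Pi UNIV B \<union> C" for g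
    proof (cases "g \<in> C")
      case True
      then have "graph g \<in> \<B>" by (simp add: \<B>_def)
      moreover have "\<forall>x. (x, g x) \<in> graph g" by (simp add: graph_def)
      ultimately show ?thesis by blast
    next
      case False
      obtain p where "p \<in> P" "\<forall>s\<in>S. p s = g s" using P(2) by blast
      then have "patch p \<in> \<B>" "\<forall>x. (x, g x) \<in> patch p"
        using False g by (auto simp: \<B>_def patch_def)
      then show ?thesis by blast
    qed
    then show ?thesis
      using gen_submonoid_cover_by_relations[of f "Pi UNIV B \<union> C" \<B>] that C(2)
      unfolding \<R>_def by blast
  qed
  have "\<R> \<noteq> {}" by (auto simp: \<R>_def)
  then have rng: "range (from_nat_into \<R>) = \<R>" using cnt\<R> by simp
  have "infinite {x. \<not> A x \<subseteq> from_nat_into \<R> n `` {x}}" for n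
    by (intro esc Q from_nat_into \<open>\<R> \<noteq> {}\<close>)
  then obtain s where s: "inj s" "\<And>n :: nat. s n \<in> {x. \<not> A x \<subseteq> from_nat_into \<R> n `` {x}}"
    using ex_inj_choice[of "\<lambda>n :: nat. {x. \<not> A x \<subseteq> from_nat_into \<R> n `` {x}}"] by auto
  then have "\<forall>n. \<exists>y. y \<in> A (s n) \<and> (s n, y) \<notin> from_nat_into \<R> n" by blast
  then obtain y where y: "\<And>n. y n \<in> A (s n)" "\<And>n. (s n, y n) \<notin> from_nat_into \<R> n"
    by metis
  define f where "f x = (if x \<in> range s then y (inv s x) else x)" for x
  have "f \<in> Pi UNIV A" using y(1) refl s(1) by (auto simp: f_def)
  then obtain n where "\<forall>x. (x, f x) \<in> from_nat_into \<R> n" using cover rng by (metis imageE)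
  then have "(s n, f (s n)) \<in> from_nat_into \<R> n" by blast
  then show False using y(2) s(1) by (simp add: f_def)
qed

text \<open>The invariant \<open>Q\<close> is finiteness of all fibres, which survives composition;
  a finite fibre cannot contain an infinite \<open>up \<rho> x\<close>.\<close>

lemma type1_not_below:
  assumes "countable (UNIV :: 'a set)" and refl: "\<And>x :: 'a. x \<in> up \<rho> x"
    and "type1 \<rho>" and fin: "finite {x. infinite (up \<rho>' x)}"
  shows "\<not> Pi UNIV (up \<rho>) \<preceq> Pi UNIV (up \<rho>')"
proof (rule not_below_if_escape[where S = "{x. infinite (up \<rho>' x)}"
      and Q = "\<lambda>R. \<forall>x. finite (R `` {x})"])
  obtain \<Gamma> where \<Gamma>: "infinite \<Gamma>" "\<And>x. x \<in> \<Gamma> \<Longrightarrow> infinite (up \<rho> x)"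
    using \<open>type1 \<rho>\<close> by (auto simp: type1_def)
  show "infinite {x. \<not> up \<rho> x \<subseteq> R `` {x}}" if "\<forall>x. finite (R `` {x})" for R :: "'a rel"
    using \<Gamma>(2) that by (intro infinite_super[OF _ \<Gamma>(1)]) (auto dest: finite_subset)
  show "\<forall>x. finite ((R O R') `` {x})"
    if "\<forall>x. finite (R `` {x})" "\<forall>x. finite (R' `` {x})" for R R' :: "'a rel"
    using that by (auto simp: relcomp_Image Image_eq_UN[of R' "R `` _"])
  show "\<forall>x. finite ({(x, y). if x \<in> {x. infinite (up \<rho>' x)} then y = p x else y \<in> up \<rho>' x} `` {x})"
    for p
  proof
    fix x show "finite ({(x, y). if x \<in> {x. infinite (up \<rho>' x)} then y = p x
      else y \<in> up \<rho>' x} `` {x})"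
      by (cases "finite (up \<rho>' x)") (auto simp: Image_def)
  qed
qed (use assms in auto)

text \<open>The invariant is a uniform bound on the fibres, and such bounds multiply under
  composition. If escape were possible at finitely many points only, the finite sets
  \<open>up \<rho> x\<close> would be uniformly bounded.\<close>

lemma type2_not_below:
  assumes "countable (UNIV :: 'a set)" and refl: "\<And>x :: 'a. x \<in> up \<rho> x"
    and "type2 \<rho>" and fin: "finite {x. \<not> card_atmost (up \<rho>' x) n}"
  shows "\<not> Pi UNIV (up \<rho>) \<preceq> Pi UNIV (up \<rho>')"
proof (rule not_below_if_escape[where S = "{x. \<not> card_atmost (up \<rho>' x) n}"
      and Q = "\<lambda>R. \<exists>N. \<forall>x. card_atmost (R `` {x}) N"])
  show "infinite {x. \<not> up \<rho> x \<subseteq> R `` {x}}" if R: "\<exists>N. \<forall>x. card_atmost (R `` {x}) N" for R :: "'a rel"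
  proof
    assume *: "finite {x. \<not> up \<rho> x \<subseteq> R `` {x}}"
    obtain N where N: "\<And>x. card_atmost (R `` {x}) N" using R by blast
    define m where "m = Max (insert N ((\<lambda>x. card (up \<rho> x)) ` {x. \<not> up \<rho> x \<subseteq> R `` {x}}))"
    have "card (up \<rho> x) \<le> m" for x
    proof (cases "up \<rho> x \<subseteq> R `` {x}")
      case True
      then have "card (up \<rho> x) \<le> N"
        using N[of x] card_mono[of "R `` {x}" "up \<rho> x"] by (auto simp: card_atmost_def)
      also have "N \<le> m" unfolding m_def using * by (intro Max_ge) auto
      finally show ?thesis .
    next
      case False
      then show ?thesis unfolding m_def using * by (intro Max_ge) auto
    qed
    then show False using \<open>type2 \<rho>\<close> by (auto simp: type2_def)
  qed
  show "\<exists>N. \<forall>x. card_atmost ((R O R') `` {x}) N"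
    if R: "\<exists>N. \<forall>x. card_atmost (R `` {x}) N" "\<exists>N. \<forall>x. card_atmost (R' `` {x}) N"
    for R R' :: "'a rel"
  proof -
    obtain N N' where N: "\<And>x. card_atmost (R `` {x}) N" "\<And>x. card_atmost (R' `` {x}) N'"
      using R by blast
    have "card_atmost ((R O R') `` {x}) (N * N')" for x
    proof -
      have eq: "(R O R') `` {x} = (\<Union>y\<in>R `` {x}. R' `` {y})" by auto
      have "card (\<Union>y\<in>R `` {x}. R' `` {y}) \<le> (\<Sum>y\<in>R `` {x}. card (R' `` {y}))"
        using N(1) by (intro card_UN_le) (auto simp: card_atmost_def)
      also have "\<dots> \<le> card (R `` {x}) * N'"
        using sum_bounded_above[of "R `` {x}" "\<lambda>y. card (R' `` {y})" N'] N(2)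
        by (auto simp: card_atmost_def)
      also have "\<dots> \<le> N * N'" using N(1)[of x] by (auto simp: card_atmost_def)
      finally show ?thesis using N unfolding eq by (auto simp: card_atmost_def)
    qed
    then show ?thesis by blast
  qed
  show "\<exists>N. \<forall>x. card_atmost ({(x, y). y = f x} `` {x}) N" for f :: "'a \<Rightarrow> 'a"
    by (rule exI[of _ 1]) (auto simp: Image_def card_atmost_def)
  show "\<exists>N. \<forall>x. card_atmost ({(x, y). if x \<in> {x. \<not> card_atmost (up \<rho>' x) n} then y = p x
      else y \<in> up \<rho>' x} `` {x}) N" for p
  proof (intro exI allI)
    fix x show "card_atmost ({(x, y). if x \<in> {x. \<not> card_atmost (up \<rho>' x) n} then y = p x
      else y \<in> up \<rho>' x} `` {x}) (max 1 n)"
      by (cases "card_atmost (up \<rho>' x) n") (auto simp: Image_def card_atmost_def)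
  qed
qed (use assms in auto)

text \<open>The invariant confines each fibre to one moving point \<open>c x\<close> and a fixed
  finite set \<open>T\<close>. For all but finitely many \<open>i\<close> both \<open>a i\<close>
  and \<open>b i\<close> avoid \<open>T\<close>, and these distinct elements of
  \<open>up \<rho> (a i)\<close> cannot both equal \<open>c (a i)\<close>.\<close>

lemma type3a_not_below:
  assumes "countable (UNIV :: 'a set)" and refl: "\<And>x :: 'a. x \<in> up \<rho> x"
    and "type3a \<rho>" and "finite \<Gamma>" and fin: "finite {x. \<not> up \<rho>' x \<subseteq> \<Gamma> \<union> {x}}"
  shows "\<not> Pi UNIV (up \<rho>) \<preceq> Pi UNIV (up \<rho>')"
proof (rule not_below_if_escape[where S = "{x. \<not> up \<rho>' x \<subseteq> \<Gamma> \<union> {x}}"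
      and Q = "\<lambda>R. \<exists>c T. finite T \<and> (\<forall>x. R `` {x} \<subseteq> insert (c x) T)"])
  obtain a b :: "nat \<Rightarrow> 'a" where ab: "inj a" "inj b" "\<And>i. a i \<noteq> b i" "\<And>i. (a i, b i) \<in> \<rho>"
    using \<open>type3a \<rho>\<close> by (auto simp: type3a_def)
  show "infinite {x. \<not> up \<rho> x \<subseteq> R `` {x}}"
    if R: "\<exists>c T. finite T \<and> (\<forall>x. R `` {x} \<subseteq> insert (c x) T)" for R :: "'a rel"
  proof -
    obtain c T where T: "finite T" "\<And>x. R `` {x} \<subseteq> insert (c x) T" using R by blast
    have "finite (a -` T \<union> b -` T)" using T(1) ab by (simp add: finite_vimageI)
    then have "infinite (- (a -` T \<union> b -` T))"
      unfolding Compl_eq_Diff_UNIV by (rule Diff_infinite_finite) simp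
    then have "infinite (a ` (- (a -` T \<union> b -` T)))"
      using ab(1) by (meson finite_imageD inj_on_subset subset_UNIV)
    moreover have "a ` (- (a -` T \<union> b -` T)) \<subseteq> {x. \<not> up \<rho> x \<subseteq> R `` {x}}"
    proof clarsimp
      fix i assume *: "a i \<notin> T" "b i \<notin> T" "up \<rho> (a i) \<subseteq> R `` {a i}"
      then have "{a i, b i} \<subseteq> insert (c (a i)) T"
        using refl[of "a i"] ab(4)[of i] T(2)[of "a i"] by (auto simp: up_def)
      then show False using * ab(3)[of i] by auto
    qed
    ultimately show ?thesis using infinite_super by blast
  qed
  show "\<exists>c T. finite T \<and> (\<forall>x. (R O R') `` {x} \<subseteq> insert (c x) T)"
    if R: "\<exists>c T. finite T \<and> (\<forall>x. R `` {x} \<subseteq> insert (c x) T)"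
      "\<exists>c T. finite T \<and> (\<forall>x. R' `` {x} \<subseteq> insert (c x) T)" for R R' :: "'a rel"
  proof -
    obtain c T c' T' where T: "finite T" "\<And>x. R `` {x} \<subseteq> insert (c x) T"
      "finite T'" "\<And>x. R' `` {x} \<subseteq> insert (c' x) T'" using R by blast
    have "(R O R') `` {x} \<subseteq> insert ((c' \<circ> c) x) (c' ` T \<union> T')" for x
      using T(2,4) by fastforce
    then show ?thesis using T(1,3) by (intro exI[of _ "c' \<circ> c"] exI[of _ "c' ` T \<union> T'"]) auto
  qed
  show "\<exists>c T. finite T \<and> (\<forall>x. {(x, y). y = f x} `` {x} \<subseteq> insert (c x) T)" for f :: "'a \<Rightarrow> 'a"
    by (rule exI[of _ f], rule exI[of _ "{}"]) auto
  show "\<exists>c T. finite T \<and> (\<forall>x. {(x, y). if x \<in> {x. \<not> up \<rho>' x \<subseteq> \<Gamma> \<union> {x}} then y = p x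
      else y \<in> up \<rho>' x} `` {x} \<subseteq> insert (c x) T)" for p
    by (rule exI[of _ "\<lambda>x. if up \<rho>' x \<subseteq> \<Gamma> \<union> {x} then x else p x"], rule exI[of _ \<Gamma>])
      (use assms(4) in auto)
qed (use assms in auto)

lemma up_eq_singleton_iff: "x \<in> up \<rho> x \<Longrightarrow> up \<rho> x = {x} \<longleftrightarrow> card_atmost (up \<rho> x) 1"
  by (auto simp: card_atmost_def card_le_Suc0_iff_eq)

text \<open>The invariant says that the relation is a partial function, which misses a value at each
  of the infinitely many points where \<open>up \<rho> x\<close> is not a singleton.\<close>

lemma type3b_not_below:
  assumes "countable (UNIV :: 'a set)" and refl: "\<And>x :: 'a. x \<in> up \<rho> x"
    and "type3b \<rho>" and fin: "finite {x. up \<rho>' x \<noteq> {x}}"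
  shows "\<not> Pi UNIV (up \<rho>) \<preceq> Pi UNIV (up \<rho>')"
proof (rule not_below_if_escape[where S = "{x. up \<rho>' x \<noteq> {x}}"
      and Q = "\<lambda>R. \<exists>c. \<forall>x. R `` {x} \<subseteq> {c x}"])
  show "infinite {x. \<not> up \<rho> x \<subseteq> R `` {x}}" if R: "\<exists>c. \<forall>x. R `` {x} \<subseteq> {c x}" for R :: "'a rel"
  proof -
    obtain c where "\<And>x. R `` {x} \<subseteq> {c x}" using R by blast
    then have "up \<rho> x = {x}" if "up \<rho> x \<subseteq> R `` {x}" for x
      using subset_singletonD[OF subset_trans[OF that]] refl[of x] by fastforce
    then have "{x. \<not> card_atmost (up \<rho> x) 1} \<subseteq> {x. \<not> up \<rho> x \<subseteq> R `` {x}}"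
      using up_eq_singleton_iff[OF refl] by blast
    then show ?thesis
      using \<open>type3b \<rho>\<close> infinite_super unfolding type3b_def type3_def by blast
  qed
  show "\<exists>c. \<forall>x. (R O R') `` {x} \<subseteq> {c x}"
    if R: "\<exists>c. \<forall>x. R `` {x} \<subseteq> {c x}" "\<exists>c. \<forall>x. R' `` {x} \<subseteq> {c x}" for R R' :: "'a rel"
  proof -
    obtain c c' where "\<And>x. R `` {x} \<subseteq> {c x}" "\<And>x. R' `` {x} \<subseteq> {c' x}" using R by blast
    then show ?thesis by (intro exI[of _ "c' \<circ> c"]) fastforce
  qed
  show "\<exists>c. \<forall>x. {(x, y). y = f x} `` {x} \<subseteq> {c x}" for f :: "'a \<Rightarrow> 'a" by auto
  show "\<exists>c. \<forall>x. {(x, y). if x \<in> {x. up \<rho>' x \<noteq> {x}} then y = p x else y \<in> up \<rho>' x} `` {x} \<subseteq> {c x}"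
    for p by (rule exI[of _ "\<lambda>x. if up \<rho>' x = {x} then x else p x"]) auto
qed (use assms in auto)

subsection \<open>Comparing preorders of the same type\<close>

text \<open>Discarding the finite set \<open>F\<close> loses only finitely many cardinalities, so
  the remaining ones are still unbounded.\<close>

lemma type2_unbounded:
  assumes "type2 \<rho>" "finite F"
  obtains \<gamma> where "\<gamma> \<notin> F" "finite (up \<rho> \<gamma>)" "N < card (up \<rho> \<gamma>)"
proof (rule ccontr)
  note bound = that
  assume none: "\<not> thesis"
  define m where "m = Max (insert N ((\<lambda>x. card (up \<rho> x)) ` F))"
  have "card (up \<rho> x) \<le> m" if finx: "finite (up \<rho> x)" for x
  proof (cases "x \<in> F")
    case True
    then show ?thesis unfolding m_def using assms(2) by (intro Max_ge) auto
  next
    case False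
    then have "card (up \<rho> x) \<le> N" using finx none bound[of x] by force
    also have "N \<le> m" unfolding m_def using assms(2) by (intro Max_ge) auto
    finally show ?thesis .
  qed
  then show False using \<open>type2 \<rho>\<close> by (auto simp: type2_def)
qed

lemma type2_below:
  assumes inf: "infinite (UNIV :: 'a set)" and cnt: "countable (UNIV :: 'a set)"
    and refl: "\<And>x :: 'a. x \<in> up \<rho>' x" and "type2 \<rho>" "type2 \<rho>'"
  shows "Pi UNIV (up \<rho>) \<preceq> Pi UNIV (up \<rho>')"
proof -
  obtain l r :: "'a \<Rightarrow> 'a" where lr: "inj l" "inj r" "\<And>x y. l x \<noteq> r y"
    using ex_inj_pair[OF inf cnt] by blast
  have S: "finite {x. infinite (up \<rho> x)}" using \<open>type2 \<rho>\<close> by (simp add: type2_def)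
  show ?thesis
  proof (rule Pi_below_without_exceptions[OF cnt S lr], rule Pi_below_if_finite_blocks[OF cnt refl])
    fix k
    let ?A = "if k \<in> l ` (- {x. infinite (up \<rho> x)}) then l ` up \<rho> (inv l k) else {k}"
    show "finite ?A" using lr(1) by auto
    fix F :: "'a set" assume "finite F"
    \<comment> \<open>The summand \<open>card F\<close> pays for the elements lost when the block is
      made disjoint from \<open>F\<close>.\<close>
    obtain \<gamma> where \<gamma>: "\<gamma> \<notin> F" "finite (up \<rho>' \<gamma>)" "card ?A + card F < card (up \<rho>' \<gamma>)"
      using type2_unbounded[OF \<open>type2 \<rho>'\<close> \<open>finite F\<close>] by blast
    then have "card ?A \<le> card (up \<rho>' \<gamma> - F)"
      using diff_card_le_card_Diff[OF \<open>finite F\<close>, of "up \<rho>' \<gamma>"] by linarith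
    then show "\<exists>\<gamma> X. \<gamma> \<notin> F \<and> X \<inter> F = {} \<and> finite X \<and> X \<subseteq> up \<rho>' \<gamma> \<and> card ?A \<le> card X"
      using \<gamma> by (intro exI[of _ \<gamma>] exI[of _ "up \<rho>' \<gamma> - F"]) auto
  qed
qed

text \<open>Boundedness of \<rho> reduces everything to binary choices, for which the pairs
  \<open>a i\<close>, \<open>b i\<close> serve as blocks. Injectivity of both sequences lets the
  pairs avoid any finite set.\<close>

lemma type3a_below:
  assumes inf: "infinite (UNIV :: 'a set)" and cnt: "countable (UNIV :: 'a set)"
    and refl: "\<And>x :: 'a. x \<in> up \<rho>' x" and "type3 \<rho>" "type3a \<rho>'"
  shows "Pi UNIV (up \<rho>) \<preceq> Pi UNIV (up \<rho>')"
proof -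
  obtain l r :: "'a \<Rightarrow> 'a" where lr: "inj l" "inj r" "\<And>x y. l x \<noteq> r y"
    using ex_inj_pair[OF inf cnt] by blast
  obtain n where S: "finite {x. \<not> card_atmost (up \<rho> x) n}"
    using \<open>type3 \<rho>\<close> by (auto simp: type3_def)
  obtain a b :: "nat \<Rightarrow> 'a" where ab: "inj a" "inj b" "\<And>i. a i \<noteq> b i" "\<And>i. (a i, b i) \<in> \<rho>'"
    using \<open>type3a \<rho>'\<close> by (auto simp: type3a_def)
  show ?thesis
  proof (rule Pi_below_without_exceptions[OF cnt S lr], rule Pi_below_if_bounded[OF inf cnt])
    fix x
    show "card_atmost (if x \<in> l ` (- {x. \<not> card_atmost (up \<rho> x) n})
      then l ` up \<rho> (inv l x) else {x}) (max 1 n)"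
      using lr(1) by (auto simp: card_atmost_def card_image inj_on_subset)
  next
    fix B :: "'a \<Rightarrow> 'a set" assume B: "\<And>x. card_atmost (B x) 2"
    show "Pi UNIV B \<preceq> Pi UNIV (up \<rho>')"
    proof (rule Pi_below_if_finite_blocks[OF cnt refl])
      show "finite (B x)" for x using B[of x] by (simp add: card_atmost_def)
      fix x and F :: "'a set" assume "finite F"
      then have "finite (a -` F \<union> b -` F)" using ab by (simp add: finite_vimageI)
      then obtain i where "i \<notin> a -` F \<union> b -` F" using ex_new_if_finite infinite_UNIV_nat by blast
      then show "\<exists>\<gamma> X. \<gamma> \<notin> F \<and> X \<inter> F = {} \<and> finite X \<and> X \<subseteq> up \<rho>' \<gamma> \<and> card (B x) \<le> card X"
        using ab(3,4)[of i] refl[of "a i"] B[of x]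
        by (intro exI[of _ "a i"] exI[of _ "{a i, b i}"]) (auto simp: card_atmost_def up_def)
    qed
  qed
qed

lemma type3b_below:
  assumes inf: "infinite (UNIV :: 'a set)" and cnt: "countable (UNIV :: 'a set)"
    and refl: "\<And>x :: 'a. x \<in> up \<rho>' x" and "type3b \<rho>" "type3b \<rho>'"
  shows "Pi UNIV (up \<rho>) \<preceq> Pi UNIV (up \<rho>')"
proof -
  obtain l r :: "'a \<Rightarrow> 'a" where lr: "inj l" "inj r" "\<And>x y. l x \<noteq> r y"
    using ex_inj_pair[OF inf cnt] by blast
  obtain \<Gamma> where \<Gamma>: "finite \<Gamma>" and S: "finite {x. \<not> up \<rho> x \<subseteq> \<Gamma> \<union> {x}}"
    using \<open>type3b \<rho>\<close> by (auto simp: type3b_def)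
  obtain \<Gamma>' where \<Gamma>': "finite \<Gamma>'" "finite {x. \<not> up \<rho>' x \<subseteq> \<Gamma>' \<union> {x}}"
    using \<open>type3b \<rho>'\<close> by (auto simp: type3b_def)
  have inf1: "infinite {x. \<not> card_atmost (up \<rho>' x) 1}"
    using \<open>type3b \<rho>'\<close> by (auto simp: type3b_def type3_def)
  \<comment> \<open>Pigeonhole: infinitely many points have a proper successor, almost all of them
    only successors in the finite set \<Gamma>', so some \<gamma> is hit infinitely often.\<close>
  have "\<exists>\<gamma>\<in>\<Gamma>'. infinite {x. x \<noteq> \<gamma> \<and> \<gamma> \<in> up \<rho>' x}"
  proof (rule ccontr)
    assume "\<not> ?thesis"
    then have "finite ({x. \<not> up \<rho>' x \<subseteq> \<Gamma>' \<union> {x}} \<union> (\<Union>\<gamma>\<in>\<Gamma>'. {x. x \<noteq> \<gamma> \<and> \<gamma> \<in> up \<rho>' x}))"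
      using \<Gamma>' by auto
    moreover have "{x. \<not> card_atmost (up \<rho>' x) 1} \<subseteq>
        {x. \<not> up \<rho>' x \<subseteq> \<Gamma>' \<union> {x}} \<union> (\<Union>\<gamma>\<in>\<Gamma>'. {x. x \<noteq> \<gamma> \<and> \<gamma> \<in> up \<rho>' x})"
      unfolding up_eq_singleton_iff[OF refl, symmetric] using refl by auto
    ultimately show False using inf1 finite_subset by blast
  qed
  then obtain \<gamma> where \<gamma>: "infinite {x. x \<noteq> \<gamma> \<and> \<gamma> \<in> up \<rho>' x}" by blast
  let ?A = "\<lambda>x. if x \<in> l ` (- {x. \<not> up \<rho> x \<subseteq> \<Gamma> \<union> {x}}) then l ` up \<rho> (inv l x) else {x}"
  show ?thesis
  proof (rule Pi_below_without_exceptions[OF cnt S lr], rule countably_below_factor[of _ _ "{id}" _ id])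
    show "Pi UNIV (\<lambda>x. insert x (l ` \<Gamma>)) \<preceq> Pi UNIV (up \<rho>')"
      by (rule Pi_below_if_finite_targets[OF inf cnt Pi_below_if_common_target[OF cnt refl \<gamma>]])
        (simp add: \<Gamma>)
    have "?A x \<subseteq> insert x (l ` \<Gamma>)" for x using lr(1) by auto
    then have "Pi UNIV ?A \<subseteq> Pi UNIV (\<lambda>x. insert x (l ` \<Gamma>))" by (rule Pi_mono)
    then show "\<exists>g\<in>Pi UNIV (\<lambda>x. insert x (l ` \<Gamma>)). \<exists>v\<in>{id}. f = v \<circ> g \<circ> id"
      if "f \<in> Pi UNIV ?A" for f using that by auto
  qed simp
qed

lemma type4_iff:
  assumes "\<And>x. x \<in> up \<rho> x"
  shows "type4 \<rho> \<longleftrightarrow> finite {x. up \<rho> x \<noteq> {x}}"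
proof -
  have "card (up \<rho> x) = 1 \<longleftrightarrow> up \<rho> x = {x}" for x using assms[of x] by (auto simp: card_1_singleton_iff)
  then show ?thesis by (simp add: type4_def)
qed

text \<open>Once the finitely many exceptional points are set aside, only the identity is left as a
  selection, and it belongs to every reflexive family.\<close>

lemma type4_below:
  assumes inf: "infinite (UNIV :: 'a set)" and cnt: "countable (UNIV :: 'a set)"
    and refl: "\<And>x :: 'a. x \<in> up \<rho> x" "\<And>x :: 'a. x \<in> up \<rho>' x" and "type4 \<rho>"
  shows "Pi UNIV (up \<rho>) \<preceq> Pi UNIV (up \<rho>')"
proof -
  obtain l r :: "'a \<Rightarrow> 'a" where lr: "inj l" "inj r" "\<And>x y. l x \<noteq> r y"
    using ex_inj_pair[OF inf cnt] by blast
  have S: "finite {x. up \<rho> x \<noteq> {x}}" using \<open>type4 \<rho>\<close> type4_iff[OF refl(1)] by simp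
  show ?thesis
  proof (rule Pi_below_without_exceptions[OF cnt S lr], rule countably_below_subset, rule Pi_mono)
    show "(if x \<in> l ` (- {x. up \<rho> x \<noteq> {x}}) then l ` up \<rho> (inv l x) else {x}) \<subseteq> up \<rho>' x" for x
      using lr(1) refl(2) by auto
  qed
qed

section \<open>Exhaustion of the types and the equivalence\<close>

lemma type_exhaust:
  fixes \<rho> :: "'a rel"
  assumes refl: "\<And>x. x \<in> up \<rho> x"
  shows "type1 \<rho> \<or> type2 \<rho> \<or> type3a \<rho> \<or> type3b \<rho> \<or> type4 \<rho>"
proof (rule ccontr)
  assume none: "\<not> ?thesis"
  have fin: "finite {x. infinite (up \<rho> x)}" using none by (auto simp: type1_def)
  obtain n where n: "\<And>x. finite (up \<rho> x) \<Longrightarrow> card (up \<rho> x) \<le> n"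
    using none fin by (auto simp: type2_def)
  have "{x. \<not> card_atmost (up \<rho> x) n} = {x. infinite (up \<rho> x)}"
    using n by (auto simp: card_atmost_def)
  moreover have "infinite {x. \<not> card_atmost (up \<rho> x) 1}"
    using none type4_iff[OF refl] up_eq_singleton_iff[OF refl] by simp
  ultimately have "type3 \<rho>" using fin unfolding type3_def by metis
  \<comment> \<open>Failure of type 3b yields, for every finite \<open>F\<close>, a pair in \<rho>
    with distinct entries that both lie outside \<open>F\<close>. Choosing such pairs greedily
    produces the sequences of type 3a.\<close>
  have not3b: "infinite {x. \<not> up \<rho> x \<subseteq> F \<union> {x}}" if "finite F" for F
    using none \<open>type3 \<rho>\<close> that by (auto simp: type3b_def)
  define P where "P y \<longleftrightarrow> fst y \<noteq> snd y \<and> y \<in> \<rho>" for y :: "'a \<times> 'a"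
  obtain s :: "nat \<Rightarrow> 'a \<times> 'a" where s: "\<And>i. P (s i)"
    "\<And>i j. i \<noteq> j \<Longrightarrow> {fst (s i), snd (s i)} \<inter> {fst (s j), snd (s j)} = {}"
  proof (rule greedy_choice[of "\<lambda>_ :: nat. P" "\<lambda>y. {fst y, snd y}"])
    fix F :: "'a set" assume "finite F"
    then obtain x where "x \<notin> F" "\<not> up \<rho> x \<subseteq> F \<union> {x}"
      using infinite_imp_nonempty[OF Diff_infinite_finite[OF _ not3b]] by blast
    then obtain y where "y \<in> up \<rho> x" "y \<notin> F" "y \<noteq> x" by blast
    then show "\<exists>y. P y \<and> {fst y, snd y} \<inter> F = {}"
      using \<open>x \<notin> F\<close> by (intro exI[of _ "(x, y)"]) (auto simp: P_def up_def)
  qed auto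
  have "inj (fst \<circ> s)" "inj (snd \<circ> s)" using s(2) by (fastforce simp: inj_def)+
  then have "type3a \<rho>" unfolding type3a_def using \<open>type3 \<rho>\<close> s(1)
    by (intro conjI exI[of _ "fst \<circ> s"] exI[of _ "snd \<circ> s"]) (auto simp: P_def)
  then show False using none by blast
qed

text \<open>The listed pairs and their reversals exhaust the pairs of different types. Type 4 enters
  the four separations as the case of bound 1 and of an empty target set.\<close>

lemma lower_type_not_below:
  fixes \<rho> \<rho>' :: "'a rel"
  assumes cnt: "countable (UNIV :: 'a set)" and refl: "\<And>x. x \<in> up \<rho> x" "\<And>x. x \<in> up \<rho>' x"
    and types: "type1 \<rho> \<and> (type2 \<rho>' \<or> type3 \<rho>' \<or> type4 \<rho>') \<or> type2 \<rho> \<and> (type3 \<rho>' \<or> type4 \<rho>')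
      \<or> type3a \<rho> \<and> (type3b \<rho>' \<or> type4 \<rho>') \<or> type3b \<rho> \<and> type4 \<rho>'"
  shows "\<not> Pi UNIV (up \<rho>) \<preceq> Pi UNIV (up \<rho>')"
proof -
  have t4: "finite {x. up \<rho>' x \<noteq> {x}}" if "type4 \<rho>'"
    using that type4_iff[OF refl(2)] by simp
  then have "finite {x. \<not> card_atmost (up \<rho>' x) 1}" if "type4 \<rho>'"
    using that up_eq_singleton_iff[OF refl(2)] by simp
  then have bounded: "\<exists>n. finite {x. \<not> card_atmost (up \<rho>' x) n}" if "type3 \<rho>' \<or> type4 \<rho>'"
    using that unfolding type3_def by blast
  have "{x. infinite (up \<rho>' x)} \<subseteq> {x. \<not> card_atmost (up \<rho>' x) n}" for n
    by (auto simp: card_atmost_def)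
  then have fin: "finite {x. infinite (up \<rho>' x)}" if "type2 \<rho>' \<or> type3 \<rho>' \<or> type4 \<rho>'"
    using that bounded unfolding type2_def by (meson finite_subset)
  have "{x. \<not> up \<rho>' x \<subseteq> {} \<union> {x}} \<subseteq> {x. up \<rho>' x \<noteq> {x}}" by auto
  then have "finite {x. \<not> up \<rho>' x \<subseteq> {} \<union> {x}}" if "type4 \<rho>'"
    using t4[OF that] finite_subset by blast
  then have "\<exists>\<Gamma>. finite \<Gamma> \<and> finite {x. \<not> up \<rho>' x \<subseteq> \<Gamma> \<union> {x}}" if "type3b \<rho>' \<or> type4 \<rho>'"
    using that unfolding type3b_def by blast
  then show ?thesis
    using types t4 bounded fin type1_not_below[OF cnt refl(1)] type2_not_below[OF cnt refl(1)]
      type3a_not_below[OF cnt refl(1)] type3b_not_below[OF cnt refl(1)] by meson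
qed

theorem theorem27:
  fixes \<rho> \<rho>' :: "'a rel"
  assumes "infinite (UNIV :: 'a set)" and "countable (UNIV :: 'a set)"
    and "preorder_on UNIV \<rho>" and "preorder_on UNIV \<rho>'"
  shows "selfmaps \<rho> \<approx>\<^sub>E selfmaps \<rho>' \<longleftrightarrow> same_type \<rho> \<rho>'"
proof -
  note inf = assms(1) and cnt = assms(2)
  have refl: "x \<in> up \<rho> x" "x \<in> up \<rho>' x" for x
    using assms(3,4) by (auto simp: preorder_on_def up_def dest: refl_onD)
  have below: "Pi UNIV (up \<sigma>) \<preceq> Pi UNIV (up \<tau>)"
    if "same_type \<sigma> \<tau>" "\<And>x. x \<in> up \<sigma> x" "\<And>x. x \<in> up \<tau> x" for \<sigma> \<tau> :: "'a rel"
  proof -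
    have "type1 \<tau> \<Longrightarrow> ?thesis"
      using Pi_below_if_infinitely_many_infinite[OF cnt that(3)] by (auto simp: type1_def)
    then show ?thesis
      using that(1) type2_below[OF inf cnt that(3)] type3a_below[OF inf cnt that(3)]
        type3b_below[OF inf cnt that(3)] type4_below[OF inf cnt that(2,3)]
      unfolding same_type_def type3a_def by blast
  qed
  \<comment> \<open>Each preorder has some type, and two different types would contradict the
    separation in one of the two directions.\<close>
  have same: "same_type \<rho> \<rho>'"
    if "Pi UNIV (up \<rho>) \<preceq> Pi UNIV (up \<rho>')" "Pi UNIV (up \<rho>') \<preceq> Pi UNIV (up \<rho>)"
    using that type_exhaust[OF refl(1)] type_exhaust[OF refl(2)]
      lower_type_not_below[OF cnt refl, unfolded atomize_imp]
      lower_type_not_below[OF cnt refl(2,1), unfolded atomize_imp]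
    unfolding same_type_def type3a_def type3b_def by argo
  have "same_type \<rho> \<rho>' \<longleftrightarrow> same_type \<rho>' \<rho>" by (auto simp: same_type_def)
  then show ?thesis
    unfolding fin_gen_equiv_iff[OF inf cnt] selfmaps_eq_Pi
    using below[of \<rho> \<rho>'] below[of \<rho>' \<rho>] same refl by blast
qed

end
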